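(* There exists $\beta<0$ such that \[ \ln p(n,3) \le \frac{1}{n-2}\binom{n}{3}\ln\bigl(\mathrm{e}^{1+\beta} n + o(n)\bigr) \qquad\text{as } n\to\infty. \]
   Context: A matroid of rank $r$ is paving if every set of fewer than $r$ elements is independent. $p(n,3)$ is the number of paving matroids of rank $3$ on the ground set $[n]=\{1,\dots,n\}$. *)

theory Defs
  imports Complex_Main "HOL-Library.Landau_Symbols"
begin

definition matroid :: "'a set \<Rightarrow> 'a set set \<Rightarrow> bool" where
  "matroid E \<I> \<longleftrightarrow>
     finite E \<and> \<I> \<subseteq> Pow E \<and> {} \<in> \<I> \<and>
     (\<forall>X\<in>\<I>. \<forall>Y. Y \<subseteq> X \<longrightarrow> Y \<in> \<I>) \<and>
     (\<forall>X\<in>\<I>. \<forall>Y\<in>\<I>. card X < card Y \<longrightarrow> (\<exists>y\<in>Y - X. insert y X \<in> \<I>))"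

definition matroid_rank :: "'a set set \<Rightarrow> nat" where
  "matroid_rank \<I> = Max (card ` \<I>)"

definition paving :: "'a set \<Rightarrow> 'a set set \<Rightarrow> bool" where
  "paving E \<I> \<longleftrightarrow> (\<forall>X. X \<subseteq> E \<and> card X < matroid_rank \<I> \<longrightarrow> X \<in> \<I>)"

text \<open>Labelled matroids are counted: a matroid on \<open>{1..n}\<close> is identified with its family of
  independent sets, and isomorphic matroids are not identified.\<close>

definition num_paving :: "nat \<Rightarrow> nat \<Rightarrow> nat" where
  "num_paving n r =
     card {\<I>. matroid {1..n} \<I> \<and> matroid_rank \<I> = r \<and> paving {1..n} \<I>}"

end

theory Submission imports Defs "HOL-Analysis.Complex_Transcendental" "HOL-Real_Asymp.Real_Asymp" begin

text \<open>
  A rank-3 paving matroid is determined by its lines with at least three points, and any two lines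
  meet in at most one point. Such a system of lines is encoded in three parts: the set \<open>U\<close> of lines
  with at least four points, a subset \<open>S\<close> of the set \<open>T\<close> of three-point lines, and \<open>R = T - S\<close>. Every
  member of \<open>R\<close> is \<^emph>\<open>available\<close>, i.e. meets each line of \<open>U \<union> S\<close> in at most one point. If \<open>S\<close> is a
  uniformly random subset of \<open>T\<close>, a triple whose three pairs are covered by three different lines is
  available with probability at most \<open>1/8\<close>, so revealing \<open>S\<close> makes the description of \<open>R\<close> cheaper; this
  is what beats the bound with \<open>\<beta> = 0\<close>.

  With weights \<open>\<mu>\<close> on the lines in \<open>U\<close>, \<open>p\<close> on those in \<open>S\<close> and \<open>q\<close> on those in \<open>R\<close>, the codes satisfy a
  Kraft inequality, since a sum of product weights over all subsets of \<open>A\<close> is at most \<open>exp\<close> of the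
  total weight of \<open>A\<close>. Hence the number of line systems is governed by the cost of the best \<open>S\<close>, which
  is at most the average cost, and the average is linear in the numbers of lines of each size and
  of uncovered pairs. The weights are \<open>p = 3/(10n)\<close>, \<open>q = 8p\<close> and \<open>\<mu> L = pq n\<^sup>2 / n^(card L - 2)\<close>: then
  every line costs at most \<open>(ln n + ln (25/18) / 2) / 3\<close> for each pair of points that it covers.
\<close>

subsection \<open>Partial linear spaces\<close>

text \<open>Two-point lines are left out: they are the pairs in \<open>uncovered\<close>, and are
  determined by the longer lines.\<close>

definition partial_linear_space :: "'a set \<Rightarrow> 'a set set \<Rightarrow> bool" where
  "partial_linear_space V \<L> \<longleftrightarrow>
     (\<forall>L\<in>\<L>. L \<subseteq> V \<and> 3 \<le> card L) \<and>
     (\<forall>L\<in>\<L>. \<forall>L'\<in>\<L>. L \<noteq> L' \<longrightarrow> card (L \<inter> L') \<le> 1)"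

definition short_lines :: "'a set set \<Rightarrow> 'a set set" where
  "short_lines \<L> = {L \<in> \<L>. card L = 3}"

definition long_lines :: "'a set set \<Rightarrow> 'a set set" where
  "long_lines \<L> = {L \<in> \<L>. 4 \<le> card L}"

definition available :: "'a set \<Rightarrow> 'a set set \<Rightarrow> 'a set set" where
  "available V \<L> = {X. X \<subseteq> V \<and> card X = 3 \<and> (\<forall>L\<in>\<L>. card (X \<inter> L) \<le> 1)}"

definition uncovered :: "'a set \<Rightarrow> 'a set set \<Rightarrow> 'a set set" where
  "uncovered V \<L> = {P. P \<subseteq> V \<and> card P = 2 \<and> (\<forall>L\<in>\<L>. \<not> P \<subseteq> L)}"

lemma partial_linear_space_lines:
  assumes "partial_linear_space V \<L>"
  shows "\<L> = long_lines \<L> \<union> short_lines \<L>"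
  using assms unfolding partial_linear_space_def long_lines_def short_lines_def by force

lemma partial_linear_space_subset_Pow:
  "partial_linear_space V \<L> \<Longrightarrow> \<L> \<subseteq> Pow V"
  unfolding partial_linear_space_def by auto

lemma partial_linear_space_card_Int:
  assumes "partial_linear_space V \<L>" "L \<in> \<L>" "L' \<in> \<L>" "L \<noteq> L'"
  shows "card (L \<inter> L') \<le> 1"
  using assms unfolding partial_linear_space_def by blast

lemma partial_linear_space_line_unique:
  assumes "finite V" "partial_linear_space V \<L>" "L \<in> \<L>" "L' \<in> \<L>" "P \<subseteq> L" "P \<subseteq> L'" "card P = 2"
  shows "L = L'"
proof (rule ccontr)
  assume "L \<noteq> L'"
  then have "card (L \<inter> L') \<le> 1"
    using partial_linear_space_card_Int assms by blast
  moreover have "finite (L \<inter> L')"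
    using assms(1-3) partial_linear_space_subset_Pow by (metis PowD finite_Int finite_subset subsetD)
  then have "card P \<le> card (L \<inter> L')"
    using assms by (intro card_mono) auto
  ultimately show False using assms by simp
qed

text \<open>The left side is the expansion of the product of \<open>1 + f x\<close> over
  \<open>A\<close>, and \<open>1 + t \<le> exp t\<close>.\<close>

lemma sum_prod_Pow_le_exp:
  fixes f :: "'a \<Rightarrow> real"
  assumes "finite A" "\<And>x. x \<in> A \<Longrightarrow> 0 \<le> f x"
  shows "(\<Sum>R\<in>Pow A. \<Prod>x\<in>R. f x) \<le> exp (\<Sum>x\<in>A. f x)"
proof -
  have "(\<Sum>R\<in>Pow A. \<Prod>x\<in>R. f x) = (\<Prod>x\<in>A. f x + 1)"
    using prod_add[OF assms(1), of f "\<lambda>_. 1"] by simp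
  also have "\<dots> \<le> (\<Prod>x\<in>A. exp (f x))"
    using assms by (intro prod_mono) (auto simp: add.commute intro: add_nonneg_nonneg)
  also have "\<dots> = exp (\<Sum>x\<in>A. f x)"
    using assms(1) by (simp add: exp_sum)
  finally show ?thesis .
qed

text \<open>Complementation in \<open>T\<close> is a bijection of \<open>Pow T\<close>, so a
  uniformly random subset has \<open>card T / 2\<close> elements on average.\<close>

lemma sum_card_Pow:
  assumes "finite T"
  shows "(\<Sum>S\<in>Pow T. real (card S)) = 2 ^ card T * real (card T) / 2"
proof -
  have "(\<Sum>S\<in>Pow T. real (card S)) = (\<Sum>S\<in>Pow T. real (card (T - S)))"
    by (rule sum.reindex_bij_witness[where i = "\<lambda>S. T - S" and j = "\<lambda>S. T - S"])
       (auto simp: double_diff)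
  also have "\<dots> = (\<Sum>S\<in>Pow T. real (card T) - real (card S))"
    using assms by (intro sum.cong refl) (auto simp: card_Diff_subset finite_subset card_mono of_nat_diff)
  also have "\<dots> = 2 ^ card T * real (card T) - (\<Sum>S\<in>Pow T. real (card S))"
    using assms by (simp add: sum_subtractf card_Pow)
  finally show ?thesis by simp
qed

text \<open>Every pair of points is uncovered or lies on exactly one line. This identity lets costs
  be charged to pairs of points later on.\<close>

lemma sum_choose_2_partial_linear_space:
  assumes "finite V" "partial_linear_space V \<L>"
  shows "(\<Sum>L\<in>\<L>. card L choose 2) + card (uncovered V \<L>) = card V choose 2"
proof -
  let ?P = "\<lambda>L. {P. P \<subseteq> L \<and> card P = 2}"
  have sub: "\<L> \<subseteq> Pow V"
    using assms partial_linear_space_subset_Pow by blast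
  have fin: "finite \<L>"
    using sub assms(1) by (meson finite_Pow_iff finite_subset)
  have finL: "finite L" if "L \<in> \<L>" for L
    using that sub assms(1) by (meson PowD finite_subset subsetD)
  have eq: "?P V = (\<Union>L\<in>\<L>. ?P L) \<union> uncovered V \<L>"
    using sub unfolding uncovered_def by blast
  have "finite (?P V)"
    using assms(1) by simp
  then have "finite (\<Union>L\<in>\<L>. ?P L)" "finite (uncovered V \<L>)"
    unfolding eq by (simp_all only: finite_Un)
  moreover have "(\<Union>L\<in>\<L>. ?P L) \<inter> uncovered V \<L> = {}"
    unfolding uncovered_def by auto
  ultimately have "card (?P V) = card (\<Union>L\<in>\<L>. ?P L) + card (uncovered V \<L>)"
    unfolding eq by (rule card_Un_disjoint)
  moreover have "card (\<Union>L\<in>\<L>. ?P L) = (\<Sum>L\<in>\<L>. card (?P L))"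
  proof (rule card_UN_disjoint[OF fin])
    show "\<forall>L\<in>\<L>. finite (?P L)"
      using finL by simp
    show "\<forall>L\<in>\<L>. \<forall>L'\<in>\<L>. L \<noteq> L' \<longrightarrow> ?P L \<inter> ?P L' = {}"
      using partial_linear_space_line_unique[OF assms] by blast
  qed
  moreover have "(\<Sum>L\<in>\<L>. card (?P L)) = (\<Sum>L\<in>\<L>. card L choose 2)"
    using finL by (intro sum.cong refl n_subsets)
  ultimately show ?thesis
    using n_subsets[OF assms(1), of 2] by simp
qed

section \<open>Available triples for a random subset of the short lines\<close>

lemma card_subsets_avoiding_le:
  assumes "finite T" "D \<subseteq> T" "3 \<le> card D"
  shows "8 * card {S \<in> Pow T. S \<inter> D = {}} \<le> 2 ^ card T"
proof -
  have "{S \<in> Pow T. S \<inter> D = {}} = Pow (T - D)"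
    by auto
  then have "8 * card {S \<in> Pow T. S \<inter> D = {}} = 2 ^ 3 * 2 ^ card (T - D)"
    using assms(1) by (simp add: card_Pow)
  also have "\<dots> \<le> 2 ^ card D * 2 ^ card (T - D)"
    using assms(3) by (intro mult_right_mono power_increasing) auto
  also have "\<dots> = 2 ^ card T"
    using assms by (metis card_Diff_subset card_mono finite_subset le_add_diff_inverse power_add)
  finally show ?thesis .
qed

text \<open>If a long line contains two points of \<open>X\<close>, then \<open>X\<close> is never
  available. Otherwise the three pairs in \<open>X\<close> lie on short lines, and these are
  distinct: each differs from \<open>X\<close>, hence meets \<open>X\<close> in exactly its pair.
  All three must be absent from \<open>S\<close>.\<close>

lemma card_available_choices_le:
  assumes V: "finite V" and pls: "partial_linear_space V \<L>"
    and X: "X \<subseteq> V" "card X = 3" "X \<notin> \<L>"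
    and cov: "\<And>P. P \<subseteq> X \<Longrightarrow> card P = 2 \<Longrightarrow> \<exists>L\<in>\<L>. P \<subseteq> L"
  shows "8 * card {S \<in> Pow (short_lines \<L>). X \<in> available V (long_lines \<L> \<union> S)}
           \<le> 2 ^ card (short_lines \<L>)"
proof (cases "\<exists>L\<in>long_lines \<L>. \<not> card (X \<inter> L) \<le> 1")
  case True
  then have "{S \<in> Pow (short_lines \<L>). X \<in> available V (long_lines \<L> \<union> S)} = {}"
    unfolding available_def by blast
  then show ?thesis by (simp only: card.empty)
next
  case False
  let ?Q = "{P. P \<subseteq> X \<and> card P = 2}"
  have finX: "finite X"
    using X V finite_subset by blast
  have "\<forall>P\<in>?Q. \<exists>L. L \<in> \<L> \<and> P \<subseteq> L"
    using cov by blast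
  then obtain l where l: "\<And>P. P \<in> ?Q \<Longrightarrow> l P \<in> \<L> \<and> P \<subseteq> l P"
    unfolding bchoice_iff by blast
  have short: "l P \<in> short_lines \<L>" and Int: "X \<inter> l P = P" if P: "P \<in> ?Q" for P
  proof -
    have "card P \<le> card (X \<inter> l P)"
      using P l[OF P] finX by (intro card_mono) auto
    then have two: "2 \<le> card (X \<inter> l P)" using P by simp
    then have "l P \<notin> long_lines \<L>"
      using False by force
    then show short: "l P \<in> short_lines \<L>"
      using l[OF P] partial_linear_space_lines[OF pls] by blast
    have "\<not> X \<subseteq> l P"
    proof
      assume "X \<subseteq> l P"
      moreover have "card (l P) = 3" "finite (l P)"
        using short unfolding short_lines_def by (auto intro: card_ge_0_finite)
      ultimately have "X = l P"
        using X(2) by (intro card_subset_eq) auto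
      then show False using X(3) l[OF P] by simp
    qed
    then have "card (X \<inter> l P) < card X"
      using finX by (intro psubset_card_mono) auto
    then have "card (X \<inter> l P) = card P"
      using two X(2) P by simp
    then show "X \<inter> l P = P"
      using card_subset_eq[of "X \<inter> l P" P] l[OF P] P finX by auto
  qed
  have "inj_on l ?Q"
    using Int by (metis (no_types, lifting) inj_onI)
  then have "card (l ` ?Q) = 3"
    using n_subsets[OF finX, of 2] X(2) by (simp add: card_image numeral_3_eq_3 numeral_2_eq_2)
  moreover have fin: "finite (short_lines \<L>)"
    using partial_linear_space_subset_Pow[OF pls] V finite_subset[of \<L> "Pow V"]
    unfolding short_lines_def by auto
  ultimately have "8 * card {S \<in> Pow (short_lines \<L>). S \<inter> l ` ?Q = {}} \<le> 2 ^ card (short_lines \<L>)"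
    using short by (intro card_subsets_avoiding_le) auto
  moreover have "l P \<notin> S" if "P \<in> ?Q" "X \<in> available V (long_lines \<L> \<union> S)" for P S
  proof
    assume "l P \<in> S"
    then have "card (X \<inter> l P) \<le> 1"
      using that(2) unfolding available_def by blast
    then show False
      using Int[OF that(1)] that(1) by simp
  qed
  then have "{S \<in> Pow (short_lines \<L>). X \<in> available V (long_lines \<L> \<union> S)}
      \<subseteq> {S \<in> Pow (short_lines \<L>). S \<inter> l ` ?Q = {}}"
    by blast
  then have "card {S \<in> Pow (short_lines \<L>). X \<in> available V (long_lines \<L> \<union> S)}
      \<le> card {S \<in> Pow (short_lines \<L>). S \<inter> l ` ?Q = {}}"
    using fin by (intro card_mono) auto
  ultimately show ?thesis by linarith
qed

text \<open>Each such triple arises from an uncovered pair by adding one point; multiplicities are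
  ignored.\<close>

lemma card_triples_with_uncovered_pair_le:
  assumes "finite V"
  shows "card {X. X \<subseteq> V \<and> card X = 3 \<and> (\<exists>P\<in>uncovered V \<L>. P \<subseteq> X)}
           \<le> card V * card (uncovered V \<L>)"
proof -
  have fin: "finite (uncovered V \<L>)"
    using assms unfolding uncovered_def by simp
  have "{X. X \<subseteq> V \<and> card X = 3 \<and> (\<exists>P\<in>uncovered V \<L>. P \<subseteq> X)}
      \<subseteq> (\<lambda>(x, P). insert x P) ` (V \<times> uncovered V \<L>)"
  proof
    fix X assume "X \<in> {X. X \<subseteq> V \<and> card X = 3 \<and> (\<exists>P\<in>uncovered V \<L>. P \<subseteq> X)}"
    then obtain P where X: "X \<subseteq> V" "card X = 3" and P: "P \<in> uncovered V \<L>" "P \<subseteq> X"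
      by blast
    have "finite P" "card P = 2"
      using P(1) unfolding uncovered_def by (auto intro: card_ge_0_finite)
    then have "card (X - P) = 1"
      using P X by (simp add: card_Diff_subset)
    then obtain x where "X - P = {x}"
      by (auto simp: card_1_singleton_iff)
    then have "X = insert x P" "x \<in> V"
      using P X by auto
    then show "X \<in> (\<lambda>(x, P). insert x P) ` (V \<times> uncovered V \<L>)"
      using P by auto
  qed
  then have "card {X. X \<subseteq> V \<and> card X = 3 \<and> (\<exists>P\<in>uncovered V \<L>. P \<subseteq> X)}
      \<le> card (V \<times> uncovered V \<L>)"
    using assms fin by (intro surj_card_le) auto
  then show ?thesis by (simp add: card_cartesian_product)
qed

text \<open>Double counting of pairs \<open>(S, X)\<close>: a triple \<open>X\<close> is available
  for at most an eighth of all \<open>S\<close>, unless it is a short line or contains an uncovered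
  pair. These exceptional triples are counted as if they were available for every
  \<open>S\<close>.\<close>

lemma sum_card_available_le:
  assumes V: "finite V" and pls: "partial_linear_space V \<L>"
  shows "(\<Sum>S\<in>Pow (short_lines \<L>). real (card (available V (long_lines \<L> \<union> S))))
           \<le> 2 ^ card (short_lines \<L>) *
              (real (card V choose 3) / 8 + real (card (short_lines \<L>))
                + real (card V) * real (card (uncovered V \<L>)))"
proof -
  let ?T = "short_lines \<L>"
  let ?G = "{X. X \<subseteq> V \<and> card X = 3}"
  let ?N = "{X. X \<subseteq> V \<and> card X = 3 \<and> (\<exists>P\<in>uncovered V \<L>. P \<subseteq> X)}"
  let ?c = "\<lambda>X. card {S \<in> Pow ?T. X \<in> available V (long_lines \<L> \<union> S)}"
  have finT: "finite ?T"
    using partial_linear_space_subset_Pow[OF pls] V finite_subset[of \<L> "Pow V"]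
    unfolding short_lines_def by auto
  have finG: "finite ?G" using V by simp
  have finN: "finite ?N" using V by simp
  have "(\<Sum>S\<in>Pow ?T. card (available V (long_lines \<L> \<union> S)))
      = (\<Sum>S\<in>Pow ?T. card {X \<in> ?G. X \<in> available V (long_lines \<L> \<union> S)})"
    by (intro sum.cong refl arg_cong[where f = card]) (auto simp: available_def)
  also have "\<dots> = (\<Sum>X\<in>?G. ?c X)"
    using finT finG by (intro sum_multicount_gen) auto
  finally have "(\<Sum>S\<in>Pow ?T. real (card (available V (long_lines \<L> \<union> S)))) = (\<Sum>X\<in>?G. real (?c X))"
    by (metis (no_types, lifting) of_nat_sum sum.cong)
  also have "\<dots> \<le> (\<Sum>X\<in>?G. 2 ^ card ?T / 8 + (if X \<in> ?T \<union> ?N then 2 ^ card ?T else 0))"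
  proof (rule sum_mono)
    fix X assume X: "X \<in> ?G"
    show "real (?c X) \<le> 2 ^ card ?T / 8 + (if X \<in> ?T \<union> ?N then 2 ^ card ?T else 0)"
    proof (cases "X \<in> ?T \<union> ?N")
      case True
      have "?c X \<le> card (Pow ?T)"
        using finT by (intro card_mono) auto
      then have "real (?c X) \<le> real (2 ^ card ?T)"
        using finT by (simp only: of_nat_le_iff card_Pow)
      then have "real (?c X) \<le> 2 ^ card ?T / 8 + 2 ^ card ?T"
        by (simp only: of_nat_power of_nat_numeral add_increasing zero_le_divide_iff zero_le_power zero_le_numeral simp_thms)
      then show ?thesis using True by (simp only: if_True)
    next
      case False
      then have "X \<notin> \<L>"
        using X unfolding short_lines_def by auto
      moreover have "\<exists>L\<in>\<L>. P \<subseteq> L" if "P \<subseteq> X" "card P = 2" for P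
        using False X that unfolding uncovered_def by blast
      ultimately have "8 * ?c X \<le> 2 ^ card ?T"
        using X by (intro card_available_choices_le[OF V pls]) auto
      then have "real (8 * ?c X) \<le> real (2 ^ card ?T)"
        by (simp only: of_nat_le_iff)
      then show ?thesis using False by simp
    qed
  qed
  also have "\<dots> = real (card ?G) * (2 ^ card ?T / 8) + 2 ^ card ?T * real (card (?G \<inter> (?T \<union> ?N)))"
    using finG by (simp only: sum.distrib sum.If_cases Collect_mem_eq) simp
  also have "\<dots> \<le> 2 ^ card ?T * (real (card V choose 3) / 8 + real (card ?T)
                + real (card V) * real (card (uncovered V \<L>)))"
  proof -
    have "card (?G \<inter> (?T \<union> ?N)) \<le> card (?T \<union> ?N)"
      using finT finN by (intro card_mono) auto
    also have "\<dots> \<le> card ?T + card ?N"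
      by (rule card_Un_le)
    also have "\<dots> \<le> card ?T + card V * card (uncovered V \<L>)"
      using card_triples_with_uncovered_pair_le[OF V] by simp
    finally have "real (card (?G \<inter> (?T \<union> ?N))) \<le> real (card ?T) + real (card V) * real (card (uncovered V \<L>))"
      by (simp flip: of_nat_add of_nat_mult)
    then have "2 ^ card ?T * real (card (?G \<inter> (?T \<union> ?N)))
        \<le> 2 ^ card ?T * (real (card ?T) + real (card V) * real (card (uncovered V \<L>)))"
      by (intro mult_left_mono) auto
    then show ?thesis
      using n_subsets[OF V, of 3] by (simp add: algebra_simps)
  qed
  finally show ?thesis .
qed

subsection \<open>Counting by weights\<close>

lemma ex_le_average:
  fixes f :: "'a \<Rightarrow> real"
  assumes "finite A" "A \<noteq> {}" "sum f A \<le> real (card A) * c"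
  shows "\<exists>x\<in>A. f x \<le> c"
proof (rule ccontr)
  assume "\<not> ?thesis"
  then have "sum (\<lambda>_. c) A < sum f A"
    using assms(1,2) by (intro sum_strict_mono) auto
  then show False using assms(3) by simp
qed

lemma sum_Sigma_eq:
  assumes "finite A" "\<And>x. finite (B x)"
  shows "sum g (Sigma A B) = (\<Sum>x\<in>A. \<Sum>y\<in>B x. g (x, y))"
  using sum.Sigma[of A B "\<lambda>x y. g (x, y)"] assms by simp

text \<open>The expression in \<open>cost\<close> is minus the logarithm of the weight of the code
  \<open>(U, S, R)\<close> of \<open>\<L>\<close>. Distinct spaces have distinct codes, each of
  weight at least \<open>exp (- C)\<close>, while the total weight of all codes is at most
  \<open>exp\<close> of the other two terms.\<close>

lemma card_partial_linear_spaces_le_exp: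
  fixes \<mu> :: "'a set \<Rightarrow> real"
  assumes V: "finite V" and p: "0 < p" and q: "0 < q" and \<mu>: "\<And>L. 0 < \<mu> L"
    and cost: "\<And>\<L>. partial_linear_space V \<L> \<Longrightarrow> \<exists>S\<subseteq>short_lines \<L>.
      q * real (card (available V (long_lines \<L> \<union> S))) - (\<Sum>L\<in>long_lines \<L>. ln (\<mu> L))
        - real (card S) * ln p - real (card (short_lines \<L> - S)) * ln q \<le> C"
  shows "real (card {\<L>. partial_linear_space V \<L>})
    \<le> exp (C + (\<Sum>L | L \<subseteq> V \<and> 4 \<le> card L. \<mu> L) + p * real (card V choose 3))"
proof -
  let ?A = "{\<L>. partial_linear_space V \<L>}"
  let ?B = "{L. L \<subseteq> V \<and> 4 \<le> card L}"
  let ?G = "{X. X \<subseteq> V \<and> card X = 3}"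
  have finB: "finite ?B" and finG: "finite ?G"
    using V by auto
  have finav: "finite (available V \<L>)" for \<L>
    using V unfolding available_def by simp
  have finA: "finite ?A"
    using V partial_linear_space_subset_Pow by (intro finite_subset[of ?A "Pow (Pow V)"]) auto
  have finL: "finite \<L>" if "partial_linear_space V \<L>" for \<L>
    using V partial_linear_space_subset_Pow[OF that] finite_subset by (metis finite_Pow_iff)
  obtain \<sigma> where \<sigma>: "\<And>\<L>. partial_linear_space V \<L> \<Longrightarrow> \<sigma> \<L> \<subseteq> short_lines \<L>"
    and \<sigma>C: "\<And>\<L>. partial_linear_space V \<L> \<Longrightarrow>
      q * real (card (available V (long_lines \<L> \<union> \<sigma> \<L>))) - (\<Sum>L\<in>long_lines \<L>. ln (\<mu> L))
        - real (card (\<sigma> \<L>)) * ln p - real (card (short_lines \<L> - \<sigma> \<L>)) * ln q \<le> C"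
    using cost by metis
  \<comment> \<open>The range of \<open>R\<close> depends on \<open>U\<close> and \<open>S\<close>:
    once these are known, only available triples remain possible. Not every element of
    \<open>\<Omega>\<close> has to come from a space.\<close>
  define \<Omega> where "\<Omega> = (SIGMA U:Pow ?B. SIGMA S:Pow ?G. Pow (available V (U \<union> S)))"
  define w where "w = (\<lambda>(U, S, R). (\<Prod>L\<in>U. \<mu> L) * ((\<Prod>L\<in>S. p) *
    (exp (- q * real (card (available V (U \<union> S)))) * (\<Prod>L\<in>(R :: 'a set set). q))))"
  define f where "f = (\<lambda>\<L>. (long_lines \<L>, \<sigma> \<L>, short_lines \<L> - \<sigma> \<L>))"
  have w0: "0 \<le> w z" for z
    using p q \<mu> unfolding w_def
    by (cases z) (auto intro!: mult_nonneg_nonneg prod_nonneg intro: less_imp_le)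
  have fin\<Omega>: "finite \<Omega>"
    using finB finG finav unfolding \<Omega>_def by (intro finite_SigmaI) auto

  \<comment> \<open>the factor \<open>exp (- q * card (available V (U \<union> S)))\<close> normalises the sum over \<open>R\<close>\<close>
  have "sum w \<Omega> = (\<Sum>U\<in>Pow ?B. \<Sum>z\<in>(SIGMA S:Pow ?G. Pow (available V (U \<union> S))). w (U, z))"
    unfolding \<Omega>_def using finB finG finav
    by (intro sum_Sigma_eq) (auto intro!: finite_SigmaI)
  also have "\<dots> = (\<Sum>U\<in>Pow ?B. \<Sum>S\<in>Pow ?G. \<Sum>R\<in>Pow (available V (U \<union> S)). w (U, S, R))"
    using finG finav by (intro sum.cong refl sum_Sigma_eq) auto
  also have "\<dots> = (\<Sum>U\<in>Pow ?B. (\<Prod>L\<in>U. \<mu> L) * (\<Sum>S\<in>Pow ?G. (\<Prod>L\<in>S. p) *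
      (exp (- q * real (card (available V (U \<union> S)))) * (\<Sum>R\<in>Pow (available V (U \<union> S)). \<Prod>L\<in>R. q))))"
    unfolding w_def by (simp add: sum_distrib_left)
  also have "\<dots> \<le> (\<Sum>U\<in>Pow ?B. (\<Prod>L\<in>U. \<mu> L) * exp (\<Sum>L\<in>?G. p))"
  proof (intro sum_mono mult_left_mono)
    fix U assume "U \<in> Pow ?B"
    have "exp (- q * real (card (available V (U \<union> S)))) * (\<Sum>R\<in>Pow (available V (U \<union> S)). \<Prod>L\<in>R. q) \<le> 1"
      for S
    proof -
      have "(\<Sum>R\<in>Pow (available V (U \<union> S)). \<Prod>L\<in>R. q) \<le> exp (\<Sum>L\<in>available V (U \<union> S). q)"
        using finav q by (intro sum_prod_Pow_le_exp) auto
      then show ?thesis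
        by (simp add: exp_minus field_simps)
    qed
    then have "(\<Sum>S\<in>Pow ?G. (\<Prod>L\<in>S. p) *
        (exp (- q * real (card (available V (U \<union> S)))) * (\<Sum>R\<in>Pow (available V (U \<union> S)). \<Prod>L\<in>R. q)))
        \<le> (\<Sum>S\<in>Pow ?G. (\<Prod>L\<in>S. p) * 1)"
      using p by (intro sum_mono mult_left_mono prod_nonneg) auto
    also have "\<dots> \<le> exp (\<Sum>L\<in>?G. p)"
      using sum_prod_Pow_le_exp[OF finG, of "\<lambda>_. p"] p by simp
    finally show "(\<Sum>S\<in>Pow ?G. (\<Prod>L\<in>S. p) *
        (exp (- q * real (card (available V (U \<union> S)))) * (\<Sum>R\<in>Pow (available V (U \<union> S)). \<Prod>L\<in>R. q)))
        \<le> exp (\<Sum>L\<in>?G. p)" .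
    show "0 \<le> (\<Prod>L\<in>U. \<mu> L)"
      using \<mu> by (intro prod_nonneg) (auto intro: less_imp_le)
  qed
  also have "\<dots> = (\<Sum>U\<in>Pow ?B. (\<Prod>L\<in>U. \<mu> L)) * exp (\<Sum>L\<in>?G. p)"
    by (simp add: sum_distrib_right)
  also have "\<dots> \<le> exp (\<Sum>L\<in>?B. \<mu> L) * exp (\<Sum>L\<in>?G. p)"
    using finB \<mu> by (intro mult_right_mono sum_prod_Pow_le_exp) (auto intro: less_imp_le)
  also have "\<dots> = exp ((\<Sum>L\<in>?B. \<mu> L) + p * real (card V choose 3))"
    using n_subsets[OF V, of 3] by (simp add: exp_add mult.commute)
  finally have kraft: "sum w \<Omega> \<le> exp ((\<Sum>L\<in>?B. \<mu> L) + p * real (card V choose 3))" .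

  have inj: "inj_on f ?A"
  proof (rule inj_onI)
    fix \<L> \<L>' assume "\<L> \<in> ?A" "\<L>' \<in> ?A" and eq: "f \<L> = f \<L>'"
    then have pls: "partial_linear_space V \<L>" "partial_linear_space V \<L>'"
      by auto
    have "long_lines \<L> = long_lines \<L>'" "short_lines \<L> = short_lines \<L>'"
      using eq \<sigma>[OF pls(1)] \<sigma>[OF pls(2)] unfolding f_def by auto
    then show "\<L> = \<L>'"
      using partial_linear_space_lines[OF pls(1)] partial_linear_space_lines[OF pls(2)] by metis
  qed
  have img: "f ` ?A \<subseteq> \<Omega>"
  proof
    fix z assume "z \<in> f ` ?A"
    then obtain \<L> where pls: "partial_linear_space V \<L>" and z: "z = f \<L>"
      by auto
    have "long_lines \<L> \<subseteq> ?B" "short_lines \<L> \<subseteq> ?G"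
      using partial_linear_space_subset_Pow[OF pls] unfolding long_lines_def short_lines_def by auto
    moreover have "short_lines \<L> - \<sigma> \<L> \<subseteq> available V (long_lines \<L> \<union> \<sigma> \<L>)"
    proof
      fix X assume X: "X \<in> short_lines \<L> - \<sigma> \<L>"
      have "card (X \<inter> L) \<le> 1" if "L \<in> long_lines \<L> \<union> \<sigma> \<L>" for L
      proof (rule partial_linear_space_card_Int[OF pls])
        show "X \<in> \<L>" "L \<in> \<L>" "X \<noteq> L"
          using X that \<sigma>[OF pls] unfolding long_lines_def short_lines_def by auto
      qed
      then show "X \<in> available V (long_lines \<L> \<union> \<sigma> \<L>)"
        using X \<open>short_lines \<L> \<subseteq> ?G\<close> unfolding available_def by blast
    qed
    ultimately show "z \<in> \<Omega>"
      using \<sigma>[OF pls] unfolding z f_def \<Omega>_def by auto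
  qed
  have wf: "exp (- C) \<le> w (f \<L>)" if pls: "partial_linear_space V \<L>" for \<L>
  proof -
    have "finite (long_lines \<L>)"
      using finL[OF pls] unfolding long_lines_def by auto
    then have "(\<Prod>L\<in>long_lines \<L>. \<mu> L) = exp (\<Sum>L\<in>long_lines \<L>. ln (\<mu> L))"
      using \<mu> by (simp add: exp_sum)
    moreover have "(\<Prod>L\<in>R. r) = exp (real (card R) * ln r)" if "0 < r" for r and R :: "'a set set"
      using that by (simp add: exp_of_nat_mult)
    ultimately have "w (f \<L>) = exp (- (q * real (card (available V (long_lines \<L> \<union> \<sigma> \<L>))) - (\<Sum>L\<in>long_lines \<L>. ln (\<mu> L))
        - real (card (\<sigma> \<L>)) * ln p - real (card (short_lines \<L> - \<sigma> \<L>)) * ln q))"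
      using p q unfolding w_def f_def by (simp only: prod.case exp_add[symmetric]) (simp add: algebra_simps)
    then show ?thesis
      using \<sigma>C[OF pls] by simp
  qed
  have "real (card ?A) * exp (- C) = (\<Sum>\<L>\<in>?A. exp (- C))"
    by simp
  also have "\<dots> \<le> (\<Sum>\<L>\<in>?A. w (f \<L>))"
    using wf by (intro sum_mono) simp
  also have "\<dots> = sum w (f ` ?A)"
    using inj by (simp add: sum.reindex)
  also have "\<dots> \<le> sum w \<Omega>"
    using img fin\<Omega> w0 by (intro sum_mono2) auto
  also note kraft
  finally have "real (card ?A) * exp (- C) \<le> exp ((\<Sum>L\<in>?B. \<mu> L) + p * real (card V choose 3))" .
  then show ?thesis
    by (simp add: exp_minus exp_add field_simps)
qed

section \<open>Cost and total weight for the explicit weights\<close>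

lemma real_choose_two: "real (n choose 2) = real n * (real n - 1) / 2"
  by (induction n) (auto simp: numeral_2_eq_2 field_simps)

lemma real_choose_three: "real (n choose 3) = real n * (real n - 1) * (real n - 2) / 6"
proof (induction n)
  case (Suc n)
  have "Suc n choose 3 = (n choose 2) + (n choose 3)"
    by (simp add: numeral_3_eq_3 numeral_2_eq_2)
  then show ?case
    using Suc by (simp add: real_choose_two field_simps)
qed simp

text \<open>Here \<open>18/25\<close> is \<open>p * q * n\<^sup>2\<close> for the weights
  \<open>p\<close>, \<open>q\<close> of short lines. The bound says that a long line costs no more
  per pair of points than a short line does on average. The \<open>ln n\<close> part and the
  constant part are compared separately; both are equalities at \<open>k = 4\<close>.\<close>

lemma neg_ln_line_weight_le:
  fixes n :: real
  assumes "1 \<le> n" "4 \<le> k"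
  shows "- ln (18/25 / n ^ (k - 2)) \<le> real (k choose 2) / 3 * (ln n + ln (25/18) / 2)"
proof -
  have k2: "2 * real (k choose 2) = real k * (real k - 1)"
    by (simp add: real_choose_two)
  have "- ln (18/25 / n ^ (k - 2)) = (real k - 2) * ln n + ln (25/18)"
    using assms by (simp add: ln_div ln_mult ln_realpow of_nat_diff)
  moreover have "(real k - 2) * ln n \<le> real (k choose 2) / 3 * ln n"
  proof (rule mult_right_mono)
    \<comment> \<open>lines with 3 and with 4 points are the only ones whose cost has the leading term of the bound\<close>
    have "0 \<le> (real k - 3) * (real k - 4)"
      using assms by (intro mult_nonneg_nonneg) auto
    then show "real k - 2 \<le> real (k choose 2) / 3"
      using k2 by (simp add: algebra_simps)
  qed (use assms in auto)
  moreover have "ln (25/18 :: real) \<le> real (k choose 2) / 3 * (ln (25/18) / 2)"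
  proof -
    have "4 * 3 \<le> real k * (real k - 1)"
      using assms by (intro mult_mono) auto
    then have "6 \<le> real (k choose 2)"
      using k2 by simp
    then have "6 * ln (25/18 :: real) \<le> real (k choose 2) * ln (25/18)"
      by (intro mult_right_mono) auto
    then show ?thesis by simp
  qed
  ultimately show ?thesis
    unfolding distrib_left by linarith
qed

text \<open>The cost is averaged over all subsets \<open>S\<close> of the short lines, and some
  \<open>S\<close> does no worse than the average. Short lines, long lines and uncovered pairs are
  each charged at most \<open>?M / 3\<close> per pair of points, so pair counting gives the main
  term. The last term collects what is charged to no pair.\<close>

lemma partial_linear_space_cost_le:
  fixes V :: "'a set"
  defines "n \<equiv> real (card V)"
  assumes V: "finite V" and n: "0 < n" "36/5 \<le> ln n" and pls: "partial_linear_space V \<L>"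
  shows "\<exists>S\<subseteq>short_lines \<L>.
      12 / (5 * n) * real (card (available V (long_lines \<L> \<union> S)))
        - (\<Sum>L\<in>long_lines \<L>. ln (18/25 / n ^ (card L - 2)))
        - real (card S) * ln (3 / (10 * n)) - real (card (short_lines \<L> - S)) * ln (12 / (5 * n))
      \<le> real (card V choose 2) / 3 * (ln n + ln (25/18) / 2)
         + 12 / (5 * n) * (real (card V choose 3) / 8 + n\<^sup>2)"
proof -
  let ?T = "short_lines \<L>" and ?U = "long_lines \<L>"
  let ?M = "ln n + ln (25/18) / 2"
  define p where "p = 3 / (10 * n)"
  define q where "q = 12 / (5 * n)"
  define t where "t = real (card ?T)"
  define u where "u = real (card (uncovered V \<L>))"
  define \<Sigma> where "\<Sigma> = (\<Sum>L\<in>?U. ln (18/25 / n ^ (card L - 2)))"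
  \<comment> \<open>This bounds the average of \<open>?f\<close>. Since \<open>card S\<close> is
    \<open>t / 2\<close> on average, the \<open>t\<close> short lines contribute
    \<open>- (ln p + ln q) / 2 = ?M\<close> each.\<close>
  define c where "c = q * (real (card V choose 3) / 8 + t + n * u) - \<Sigma> + t * ?M"
  let ?f = "\<lambda>S. q * real (card (available V (?U \<union> S))) - \<Sigma> - real (card S) * ln p
    - real (card (?T - S)) * ln q"
  have finL: "finite \<L>"
    using V partial_linear_space_subset_Pow[OF pls] finite_subset by (metis finite_Pow_iff)
  have finT: "finite ?T" and finU: "finite ?U"
    using finL unfolding short_lines_def long_lines_def by auto
  have q0: "0 < q" using n unfolding q_def by simp
  have ln1: "1 \<le> n"
    using n by (smt (verit) ln_less_zero_iff zero_le_divide_iff)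
  have lnpq: "ln p + ln q = - 2 * ?M"
  proof -
    have "ln p + ln q = ln (18/25 / n\<^sup>2)"
      using n unfolding p_def q_def by (subst ln_mult_pos[symmetric]) (auto simp: power2_eq_square)
    also have "\<dots> = - 2 * ?M"
      using n by (simp add: ln_div ln_mult ln_realpow field_simps)
    finally show ?thesis .
  qed
  have card_diff: "real (card (?T - S)) = t - real (card S)" if "S \<in> Pow ?T" for S
    using that finT unfolding t_def
    by (auto simp: card_Diff_subset finite_subset card_mono of_nat_diff)
  have "sum ?f (Pow ?T) = (\<Sum>S\<in>Pow ?T. q * real (card (available V (?U \<union> S))) - (\<Sigma> + t * ln q)
      + (ln q - ln p) * real (card S))"
    by (intro sum.cong refl) (simp only: card_diff, simp add: algebra_simps)
  also have "\<dots> = q * (\<Sum>S\<in>Pow ?T. real (card (available V (?U \<union> S))))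
      - 2 ^ card ?T * (\<Sigma> + t * ln q) + (ln q - ln p) * (\<Sum>S\<in>Pow ?T. real (card S))"
    using finT by (simp add: sum.distrib sum_subtractf sum_distrib_left card_Pow)
  also have "\<dots> \<le> q * (2 ^ card ?T * (real (card V choose 3) / 8 + t + n * u))
      - 2 ^ card ?T * (\<Sigma> + t * ln q) + (ln q - ln p) * (2 ^ card ?T * t / 2)"
    using sum_card_available_le[OF V pls] q0 unfolding sum_card_Pow[OF finT] t_def u_def n_def
    by (intro add_right_mono diff_right_mono mult_left_mono) auto
  also have "\<dots> = 2 ^ card ?T * (q * (real (card V choose 3) / 8 + t + n * u) - \<Sigma> - t * (ln p + ln q) / 2)"
    by (simp add: algebra_simps add_divide_distrib diff_divide_distrib)
  also have "\<dots> = real (card (Pow ?T)) * c"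
    using finT unfolding lnpq c_def by (simp add: card_Pow field_simps)
  finally have "\<exists>S\<in>Pow ?T. ?f S \<le> c"
    using finT by (intro ex_le_average) auto
  moreover have "c \<le> real (card V choose 2) / 3 * ?M + q * (real (card V choose 3) / 8 + n\<^sup>2)"
  proof -
    have "\<L> = ?U \<union> ?T" "?U \<inter> ?T = {}"
      using partial_linear_space_lines[OF pls] unfolding short_lines_def long_lines_def by auto
    then have "(\<Sum>L\<in>\<L>. card L choose 2) = (\<Sum>L\<in>?U. card L choose 2) + (\<Sum>L\<in>?T. card L choose 2)"
      using finU finT by (metis sum.union_disjoint)
    also have "(\<Sum>L\<in>?T. card L choose 2) = (\<Sum>L\<in>?T. 3)"
      by (intro sum.cong refl) (simp add: short_lines_def numeral_3_eq_3 numeral_2_eq_2)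
    finally have "(\<Sum>L\<in>?U. card L choose 2) + 3 * card ?T + card (uncovered V \<L>) = card V choose 2"
      using sum_choose_2_partial_linear_space[OF V pls] by simp
    then have "real ((\<Sum>L\<in>?U. card L choose 2) + 3 * card ?T + card (uncovered V \<L>)) = real (card V choose 2)"
      by (rule arg_cong)
    then have pairs: "(\<Sum>L\<in>?U. real (card L choose 2)) + 3 * t + u = real (card V choose 2)"
      unfolding t_def u_def by simp
    have "- \<Sigma> = (\<Sum>L\<in>?U. - ln (18/25 / n ^ (card L - 2)))"
      unfolding \<Sigma>_def by (simp add: sum_negf)
    also have "\<dots> \<le> (\<Sum>L\<in>?U. real (card L choose 2) / 3 * ?M)"
      using ln1 by (intro sum_mono neg_ln_line_weight_le) (auto simp: long_lines_def)
    also have "\<dots> = (\<Sum>L\<in>?U. real (card L choose 2)) / 3 * ?M"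
      by (simp add: sum_distrib_right sum_divide_distrib)
    finally have long: "- \<Sigma> \<le> (\<Sum>L\<in>?U. real (card L choose 2)) / 3 * ?M" .
    \<comment> \<open>The assumption \<open>36/5 \<le> ln n\<close> is three times
      \<open>12/5\<close>: an uncovered pair is then charged at most \<open>?M / 3\<close>, like a
      covered one.\<close>
    have "q * n * u = 12/5 * u"
      using n unfolding q_def by simp
    also have "\<dots> \<le> ?M / 3 * u"
    proof (rule mult_right_mono)
      have "36/5 + 0 \<le> ?M"
        using n(2) by (rule add_mono) simp
      then show "12/5 \<le> ?M / 3" by simp
    qed (simp add: u_def)
    finally have unc: "q * n * u \<le> u / 3 * ?M" by (simp add: mult.commute)
    \<comment> \<open>The crude bound \<open>t \<le> n\<^sup>2\<close> suffices, because
      \<open>q * n\<^sup>2\<close> is only linear in \<open>n\<close>.\<close>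
    have "real (card V choose 2) \<le> n\<^sup>2"
      using ln1 unfolding n_def real_choose_two by (simp add: power2_eq_square field_simps)
    moreover have "0 \<le> (\<Sum>L\<in>?U. real (card L choose 2))" "0 \<le> u" "0 \<le> t"
      by (auto simp: u_def t_def sum_nonneg)
    ultimately have "t \<le> n\<^sup>2"
      using pairs by linarith
    then have "q * t \<le> q * n\<^sup>2"
      using q0 by simp
    moreover have "real (card V choose 2) / 3 * ?M
        = (\<Sum>L\<in>?U. real (card L choose 2)) / 3 * ?M + t * ?M + u / 3 * ?M"
      unfolding pairs[symmetric] by (simp add: algebra_simps add_divide_distrib)
    ultimately show ?thesis
      using long unc unfolding c_def by (simp add: algebra_simps)
  qed
  ultimately obtain S where "S \<subseteq> ?T" "?f S \<le> real (card V choose 2) / 3 * ?M + q * (real (card V choose 3) / 8 + n\<^sup>2)"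
    by (meson PowD order_trans)
  then show ?thesis
    unfolding p_def q_def \<Sigma>_def by blast
qed

text \<open>The tail of the series of \<open>exp 1\<close>: the terms before \<open>k = 4\<close>
  add up to \<open>8/3\<close>, and \<open>272/100 - 8/3 = 4/75\<close>.\<close>

lemma sum_inverse_fact_le: "(\<Sum>k = 4..m. 1 / fact k) \<le> (4/75 :: real)"
proof -
  have "(\<lambda>k. 1 / fact k) sums exp (1::real)"
    using exp_converges[of "1::real"] by (simp add: divide_inverse)
  \<comment> \<open>Summing up to \<open>m + 4\<close> lets the first four terms be split off for
    every \<open>m\<close>, however small.\<close>
  then have "(\<Sum>k<Suc (m + 4). 1 / fact k) \<le> exp (1::real)"
    by (metis sums_unique sums_summable sum_le_suminf finite_lessThan divide_nonneg_pos fact_gt_zero zero_le_one)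
  also have "\<dots> \<le> 272/100"
    using e_less_272 by simp
  finally have "(\<Sum>k<Suc (m + 4). 1 / fact k) \<le> (272/100 :: real)" .
  moreover have "(\<Sum>k<Suc (m + 4). 1 / fact k) = (\<Sum>k<4. 1 / fact k) + (\<Sum>k = 4..m+4. 1 / fact k :: real)"
  proof -
    have "{..<Suc (m + 4)} = {..<4} \<union> {4..m+4}"
      by auto
    moreover have "(\<Sum>k\<in>{..<4} \<union> {4..m+4}. 1 / fact k)
        = (\<Sum>k<4. 1 / fact k) + (\<Sum>k = 4..m+4. 1 / fact k :: real)"
      by (rule sum.union_disjoint) auto
    ultimately show ?thesis by (simp only:)
  qed
  moreover have "(\<Sum>k<4. 1 / fact k :: real) = 8/3"
    by (simp add: numeral_eq_Suc)
  moreover have "(\<Sum>k = 4..m. 1 / fact k) \<le> (\<Sum>k = 4..m+4. 1 / fact k :: real)"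
    by (intro sum_mono2) auto
  ultimately show ?thesis by linarith
qed

text \<open>By \<open>card V choose k \<le> n ^ k / fact k\<close>, the sets of size
  \<open>k\<close> have total weight at most \<open>18/25 * n\<^sup>2 / fact k\<close>.\<close>

lemma sum_line_weights_le:
  fixes V :: "'a set"
  defines "n \<equiv> real (card V)"
  assumes V: "finite V" and n: "0 < n"
  shows "(\<Sum>L | L \<subseteq> V \<and> 4 \<le> card L. 18/25 / n ^ (card L - 2)) \<le> 24/625 * n\<^sup>2"
proof -
  let ?B = "{L. L \<subseteq> V \<and> 4 \<le> card L}"
  have "(\<Sum>L\<in>?B. 18/25 / n ^ (card L - 2))
      = (\<Sum>k\<in>{4..card V}. \<Sum>L\<in>{L \<in> ?B. card L = k}. 18/25 / n ^ (card L - 2))"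
    using V by (intro sum.group[symmetric]) (auto intro: card_mono)
  also have "\<dots> = (\<Sum>k\<in>{4..card V}. real (card V choose k) * (18/25 / n ^ (k - 2)))"
  proof (rule sum.cong[OF refl])
    fix k assume k: "k \<in> {4..card V}"
    then have "{L \<in> ?B. card L = k} = {L. L \<subseteq> V \<and> card L = k}"
      by auto
    then show "(\<Sum>L\<in>{L \<in> ?B. card L = k}. 18/25 / n ^ (card L - 2))
        = real (card V choose k) * (18/25 / n ^ (k - 2))"
      using n_subsets[OF V, of k] by simp
  qed
  also have "\<dots> \<le> (\<Sum>k\<in>{4..card V}. 18/25 * n\<^sup>2 * (1 / fact k))"
  proof (rule sum_mono)
    fix k assume k: "k \<in> {4..card V}"
    have "real ((card V choose k) * fact k) \<le> real (card V ^ k)"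
      using binomial_fact_pow of_nat_le_iff by blast
    then have "real (card V choose k) \<le> n ^ k / fact k"
      unfolding n_def by (simp add: field_simps)
    then have "real (card V choose k) * (18/25 / n ^ (k - 2)) \<le> n ^ k / fact k * (18/25 / n ^ (k - 2))"
      using n by (intro mult_right_mono) auto
    also have "n ^ k = n ^ (2 + (k - 2))"
      using k by (intro arg_cong[where f = "\<lambda>j. n ^ j"]) auto
    also have "\<dots> = n\<^sup>2 * n ^ (k - 2)"
      by (rule power_add)
    finally show "real (card V choose k) * (18/25 / n ^ (k - 2)) \<le> 18/25 * n\<^sup>2 * (1 / fact k)"
      using n by simp
  qed
  also have "\<dots> = 18/25 * n\<^sup>2 * (\<Sum>k\<in>{4..card V}. 1 / fact k)"
    by (simp add: sum_distrib_left)
  also have "\<dots> \<le> 18/25 * n\<^sup>2 * (4/75)"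
    by (intro mult_left_mono sum_inverse_fact_le) auto
  finally show ?thesis by simp
qed

text \<open>The coefficient \<open>173/1250\<close> is \<open>1/20 + 1/20 + 24/625\<close>:
  available triples, the weight \<open>p\<close> on all triples, and the long lines. The choice
  \<open>q = 8 * p\<close> makes the first two equal.\<close>

lemma card_partial_linear_spaces_le:
  fixes V :: "'a set"
  defines "n \<equiv> real (card V)"
  assumes V: "finite V" and n: "0 < n" "36/5 \<le> ln n"
  shows "real (card {\<L>. partial_linear_space V \<L>})
    \<le> exp (n * (n - 1) / 6 * (ln n + 1/6) + 173/1250 * n\<^sup>2 + 12/5 * n)"
proof -
  let ?M = "ln n + ln (25/18) / 2"
  have n1: "1 \<le> card V"
    using n unfolding n_def by simp
  have c2: "real (card V choose 2) = n * (n - 1) / 2"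
    unfolding n_def by (rule real_choose_two)
  have "real ((card V choose 3) * fact 3) \<le> real (card V ^ 3)"
    using binomial_fact_pow of_nat_le_iff by blast
  then have c3: "real (card V choose 3) \<le> n ^ 3 / 6"
    unfolding n_def by (simp add: fact_numeral)
  \<comment> \<open>The quadratic Taylor polynomial of \<open>exp\<close> at \<open>1/3\<close> is
    exactly \<open>25/18\<close>.\<close>
  have "1 + 1/3 + (1/3)\<^sup>2 / 2 \<le> exp (1/3 :: real)"
    by (rule exp_lower_Taylor_quadratic) simp
  then have "ln (25/18 :: real) \<le> ln (exp (1/3))"
    by (subst ln_le_cancel_iff) (auto simp: power2_eq_square)
  then have "ln (25/18 :: real) \<le> 1/3"
    by (simp only: ln_exp)
  then have "real (card V choose 2) / 3 * ?M \<le> n * (n - 1) / 6 * (ln n + 1/6)"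
    using n1 unfolding c2 n_def by (auto intro!: mult_left_mono)
  moreover have "12 / (5 * n) * (real (card V choose 3) / 8 + n\<^sup>2) \<le> n\<^sup>2 / 20 + 12/5 * n"
  proof -
    have "12 / (5 * n) * (real (card V choose 3) / 8 + n\<^sup>2) \<le> 12 / (5 * n) * (n ^ 3 / 6 / 8 + n\<^sup>2)"
      using c3 n by (intro mult_left_mono) auto
    also have "\<dots> = n\<^sup>2 / 20 + 12/5 * n"
      using n by (simp add: field_simps power2_eq_square power3_eq_cube)
    finally show ?thesis .
  qed
  moreover have "3 / (10 * n) * real (card V choose 3) \<le> n\<^sup>2 / 20"
  proof -
    have "3 / (10 * n) * real (card V choose 3) \<le> 3 / (10 * n) * (n ^ 3 / 6)"
      using c3 n by (intro mult_left_mono) auto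
    also have "\<dots> = n\<^sup>2 / 20"
      using n by (simp add: field_simps power2_eq_square power3_eq_cube)
    finally show ?thesis .
  qed
  moreover have "(\<Sum>L | L \<subseteq> V \<and> 4 \<le> card L. 18/25 / n ^ (card L - 2)) \<le> 24/625 * n\<^sup>2"
    using sum_line_weights_le[OF V] n unfolding n_def by simp
  ultimately have "real (card V choose 2) / 3 * ?M + 12 / (5 * n) * (real (card V choose 3) / 8 + n\<^sup>2)
      + (\<Sum>L | L \<subseteq> V \<and> 4 \<le> card L. 18/25 / n ^ (card L - 2)) + 3 / (10 * n) * real (card V choose 3)
      \<le> n * (n - 1) / 6 * (ln n + 1/6) + (n\<^sup>2 / 20 + 12/5 * n) + 24/625 * n\<^sup>2 + n\<^sup>2 / 20"
    by (intro add_mono)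
  also have "\<dots> = n * (n - 1) / 6 * (ln n + 1/6) + 173/1250 * n\<^sup>2 + 12/5 * n"
    by simp
  finally have "real (card V choose 2) / 3 * ?M + 12 / (5 * n) * (real (card V choose 3) / 8 + n\<^sup>2)
      + (\<Sum>L | L \<subseteq> V \<and> 4 \<le> card L. 18/25 / n ^ (card L - 2)) + 3 / (10 * n) * real (card V choose 3)
      \<le> n * (n - 1) / 6 * (ln n + 1/6) + 173/1250 * n\<^sup>2 + 12/5 * n" .
  moreover have "real (card {\<L>. partial_linear_space V \<L>})
    \<le> exp (real (card V choose 2) / 3 * ?M + 12 / (5 * n) * (real (card V choose 3) / 8 + n\<^sup>2)
      + (\<Sum>L | L \<subseteq> V \<and> 4 \<le> card L. 18/25 / n ^ (card L - 2)) + 3 / (10 * n) * real (card V choose 3))"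
    using n partial_linear_space_cost_le[OF V] unfolding n_def
    by (intro card_partial_linear_spaces_le_exp[OF V, where q = "12 / (5 * real (card V))"]) auto
  ultimately show ?thesis
    by (meson exp_le_cancel_iff order_trans)
qed

subsection \<open>Lines of a paving matroid of rank three\<close>

text \<open>For distinct \<open>x\<close>, \<open>y\<close> in a paving matroid of rank 3 this is
  the closure of \<open>{x, y}\<close>. The cardinality condition puts \<open>x\<close> and
  \<open>y\<close> themselves on the line, although \<open>{x, y}\<close> is independent.\<close>

definition line :: "'a set \<Rightarrow> 'a set set \<Rightarrow> 'a \<Rightarrow> 'a \<Rightarrow> 'a set" where
  "line E \<I> x y = {z \<in> E. {x, y, z} \<notin> \<I> \<or> card {x, y, z} \<noteq> 3}"

definition matroid_lines :: "'a set \<Rightarrow> 'a set set \<Rightarrow> 'a set set" where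
  "matroid_lines E \<I> = {line E \<I> x y | x y. x \<in> E \<and> y \<in> E \<and> x \<noteq> y \<and> 3 \<le> card (line E \<I> x y)}"

context
  fixes E :: "'a set" and \<I> :: "'a set set"
  assumes mat: "matroid E \<I>" and rank: "matroid_rank \<I> = 3" and pav: "paving E \<I>"
begin

lemma line_commute: "line E \<I> x y = line E \<I> y x"
  unfolding line_def insert_commute[of x y] ..

lemma line_eqI:
  assumes "x \<in> E" "y \<in> E" "x \<noteq> y" "p \<in> line E \<I> x y" "p \<noteq> x"
  shows "line E \<I> x p = line E \<I> x y"
proof -
  \<comment> \<open>This gives one inclusion; the other follows by exchanging \<open>y\<close> and
    \<open>p\<close>. If \<open>{x, z, w}\<close> were an independent triple, it would augment
    \<open>{x, y}\<close> by \<open>z\<close> or \<open>w\<close>, but both are on the line through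
    \<open>x\<close> and \<open>y\<close>.\<close>
  have ex: "w \<in> line E \<I> x z" if "x \<in> E" "y \<in> E" "x \<noteq> y" "z \<in> line E \<I> x y" "w \<in> line E \<I> x y" for y z w
  proof (rule ccontr)
    assume "w \<notin> line E \<I> x z"
    then have Y: "{x, z, w} \<in> \<I>" "card {x, z, w} = 3"
      using that unfolding line_def by auto
    have "card {x, y} = 2" using that by simp
    moreover have "{x, y} \<in> \<I>"
      using pav that rank unfolding paving_def by simp
    ultimately obtain e where "e \<in> {x, z, w} - {x, y}" "insert e {x, y} \<in> \<I>"
      using mat Y unfolding matroid_def by (metis lessI numeral_2_eq_2 numeral_3_eq_3)
    then have "e \<in> {z, w}" "{x, y, e} \<in> \<I>" "card {x, y, e} = 3"
      using that by (auto simp: insert_commute)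
    then show False
      using that unfolding line_def by auto
  qed
  have "p \<in> E" using assms unfolding line_def by simp
  have "y \<in> line E \<I> x p"
    using assms unfolding line_def by (auto simp: insert_commute)
  then show ?thesis
    using ex[of y p] ex[of p y] assms \<open>p \<in> E\<close> by (intro equalityI subsetI) metis+
qed

text \<open>The two points spanning the line are replaced one at a time by
  \<open>line_eqI\<close>.\<close>

lemma line_through:
  assumes "x \<in> E" "y \<in> E" "x \<noteq> y" "p \<in> line E \<I> x y" "q \<in> line E \<I> x y" "p \<noteq> q"
  shows "line E \<I> p q = line E \<I> x y"
proof (cases "p = x")
  case True
  then show ?thesis using line_eqI[of x y q] assms by auto
next
  case False
  then have "line E \<I> p x = line E \<I> x y"
    using line_eqI[of x y p] assms line_commute by auto
  moreover have "p \<in> E" using assms unfolding line_def by auto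
  ultimately show ?thesis
    using line_eqI[of p x q] assms False by auto
qed

lemma partial_linear_space_matroid_lines: "partial_linear_space E (matroid_lines E \<I>)"
  unfolding partial_linear_space_def
proof (intro conjI ballI impI)
  fix L assume "L \<in> matroid_lines E \<I>"
  then show "L \<subseteq> E" "3 \<le> card L"
    unfolding matroid_lines_def line_def by auto
next
  fix L L' assume L: "L \<in> matroid_lines E \<I>" "L' \<in> matroid_lines E \<I>" "L \<noteq> L'"
  show "card (L \<inter> L') \<le> 1"
  proof (rule ccontr)
    assume "\<not> ?thesis"
    then obtain p q where "p \<in> L \<inter> L'" "q \<in> L \<inter> L'" "p \<noteq> q"
      by (metis One_nat_def card_le_Suc0_iff_eq card.infinite nat_le_linear not_less_eq_eq)
    moreover have "K = line E \<I> p q" if "K \<in> matroid_lines E \<I>" "p \<in> K" "q \<in> K" for K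
    proof -
      obtain x y where "x \<in> E" "y \<in> E" "x \<noteq> y" "K = line E \<I> x y"
        using \<open>K \<in> matroid_lines E \<I>\<close> unfolding matroid_lines_def by blast
      then show ?thesis
        using line_through[of x y p q] that \<open>p \<noteq> q\<close> by simp
    qed
    ultimately show False using L by blast
  qed
qed

text \<open>The lines determine the matroid. Sets of at most two points are independent by paving,
  none has more than three points by the rank, and a dependent triple lies on the line through two
  of its points, which is therefore in \<open>matroid_lines\<close>.\<close>

lemma independent_sets_eq:
  "\<I> = {X. X \<subseteq> E \<and> (card X \<le> 2 \<or> card X = 3 \<and> (\<forall>L\<in>matroid_lines E \<I>. \<not> X \<subseteq> L))}"
proof (intro set_eqI iffI)
  fix X assume X: "X \<in> \<I>"
  have "finite E" "\<I> \<subseteq> Pow E"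
    using mat unfolding matroid_def by auto
  then have "finite \<I>" by (meson finite_Pow_iff finite_subset)
  then have "card X \<le> 3"
    using X rank unfolding matroid_rank_def by (metis Max_ge finite_imageI imageI)
  moreover have False if "card X = 3" "L \<in> matroid_lines E \<I>" "X \<subseteq> L" for L
  proof -
    obtain u v w where uvw: "X = {u, v, w}" "u \<noteq> v"
      using \<open>card X = 3\<close> by (auto simp: card_3_iff)
    then have "w \<in> line E \<I> u v"
      using that line_through[of _ _ u v] unfolding matroid_lines_def by auto
    then show False
      using uvw X that unfolding line_def by auto
  qed
  ultimately show "X \<in> {X. X \<subseteq> E \<and> (card X \<le> 2 \<or> card X = 3 \<and> (\<forall>L\<in>matroid_lines E \<I>. \<not> X \<subseteq> L))}"
    using X \<open>\<I> \<subseteq> Pow E\<close> by force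
next
  fix X assume X: "X \<in> {X. X \<subseteq> E \<and> (card X \<le> 2 \<or> card X = 3 \<and> (\<forall>L\<in>matroid_lines E \<I>. \<not> X \<subseteq> L))}"
  show "X \<in> \<I>"
  proof (cases "card X \<le> 2")
    case True
    then show ?thesis
      using X pav rank unfolding paving_def by auto
  next
    case False
    then have X3: "card X = 3" and nl: "\<And>L. L \<in> matroid_lines E \<I> \<Longrightarrow> \<not> X \<subseteq> L"
      using X by auto
    obtain u v w where uvw: "X = {u, v, w}" "u \<noteq> v"
      using X3 by (auto simp: card_3_iff)
    show ?thesis
    proof (rule ccontr)
      assume "X \<notin> \<I>"
      then have sub: "X \<subseteq> line E \<I> u v"
        using X uvw unfolding line_def by (auto simp: card_insert_if)
      moreover have "finite (line E \<I> u v)"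
        using mat unfolding line_def matroid_def by auto
      ultimately have "3 \<le> card (line E \<I> u v)"
        using X3 card_mono by metis
      then have "line E \<I> u v \<in> matroid_lines E \<I>"
        using uvw X unfolding matroid_lines_def by auto
      then show False using nl sub by blast
    qed
  qed
qed

end

section \<open>From line systems to the asymptotic bound\<close>

lemma num_paving_3_le: "num_paving n 3 \<le> card {\<L>. partial_linear_space {1..n} \<L>}"
proof -
  let ?A = "{\<I>. matroid {1..n} \<I> \<and> matroid_rank \<I> = 3 \<and> paving {1..n} \<I>}"
  have "inj_on (matroid_lines {1..n}) ?A"
  proof (rule inj_onI)
    let ?F = "\<lambda>\<L>. {X. X \<subseteq> {1..n} \<and> (card X \<le> 2 \<or> card X = 3 \<and> (\<forall>L\<in>\<L>. \<not> X \<subseteq> L))}"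
    fix \<I> \<J> assume \<I>: "\<I> \<in> ?A" and \<J>: "\<J> \<in> ?A"
      and eq: "matroid_lines {1..n} \<I> = matroid_lines {1..n} \<J>"
    have "\<I> = ?F (matroid_lines {1..n} \<I>)"
      using \<I> by (intro independent_sets_eq) auto
    also have "\<dots> = ?F (matroid_lines {1..n} \<J>)"
      unfolding eq ..
    also have "\<dots> = \<J>"
      using \<J> by (intro independent_sets_eq[symmetric]) auto
    finally show "\<I> = \<J>" .
  qed
  moreover have "matroid_lines {1..n} ` ?A \<subseteq> {\<L>. partial_linear_space {1..n} \<L>}"
    using partial_linear_space_matroid_lines by blast
  moreover have "finite {\<L>. partial_linear_space {1..n} \<L>}"
  proof (rule finite_subset)
    show "{\<L>. partial_linear_space {1..n} \<L>} \<subseteq> Pow (Pow {1..n})"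
      using partial_linear_space_subset_Pow by blast
  qed simp
  ultimately show ?thesis
    unfolding num_paving_def by (rule card_inj_on_le)
qed

text \<open>The witnesses are \<open>\<beta> = - 1/1000\<close> and the zero function for the error
  term.\<close>

theorem theorem16:
  "\<exists>\<beta>::real. \<beta> < 0 \<and>
     (\<exists>f::nat \<Rightarrow> real. f \<in> o(\<lambda>n. real n) \<and>
       (\<forall>\<^sub>F n in sequentially.
          ln (real (num_paving n 3)) \<le>
            1 / (real n - 2) * real (n choose 3) * ln (exp (1 + \<beta>) * real n + f n)))"
proof -
  have "\<forall>\<^sub>F n in sequentially. 36/5 \<le> ln (real n)"
    by real_asymp
  \<comment> \<open>The quadratic coefficients decide: \<open>173/1250 = 0.1384\<close> lies just
    below \<open>(999/1000 - 1/6) / 6\<close>, which is about \<open>0.1387\<close>. This narrow gap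
    is the room for a negative \<open>\<beta>\<close>.\<close>
  moreover have "\<forall>\<^sub>F n in sequentially. 173/1250 * (real n)\<^sup>2 + 12/5 * real n
      \<le> real n * (real n - 1) / 6 * (999/1000 - 1/6)"
    by real_asymp
  moreover have "\<forall>\<^sub>F n in sequentially. (3::nat) \<le> n"
    by (rule eventually_ge_at_top)
  ultimately have "\<forall>\<^sub>F n in sequentially. ln (real (num_paving n 3)) \<le>
      1 / (real n - 2) * real (n choose 3) * ln (exp (1 + (- 1/1000)) * real n + 0)"
  proof eventually_elim
    case (elim n)
    let ?C = "real n * (real n - 1) / 6 * (ln (real n) + 999/1000)"
    have C0: "0 \<le> ?C"
      using elim by auto
    have "1 / (real n - 2) * real (n choose 3) = real n * (real n - 1) / 6"
      using elim by (simp add: real_choose_three)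
    moreover have "ln (exp (1 + (- 1/1000)) * real n + 0) = ln (real n) + 999/1000"
      using elim by (simp add: ln_mult_pos)
    ultimately have rhs: "1 / (real n - 2) * real (n choose 3) * ln (exp (1 + (- 1/1000)) * real n + 0) = ?C"
      by (simp only:)
    have "real (num_paving n 3) \<le> real (card {\<L>. partial_linear_space {1..n} \<L>})"
      using num_paving_3_le by simp
    also have "\<dots> \<le> exp (real n * (real n - 1) / 6 * (ln (real n) + 1/6) + 173/1250 * (real n)\<^sup>2 + 12/5 * real n)"
      using card_partial_linear_spaces_le[of "{1..n}"] elim by simp
    also have "\<dots> \<le> exp ?C"
    proof -
      have "?C = real n * (real n - 1) / 6 * (ln (real n) + 1/6)
          + real n * (real n - 1) / 6 * (999/1000 - 1/6)"
        unfolding distrib_left[symmetric] by simp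
      then show ?thesis
        using elim(2) unfolding exp_le_cancel_iff add.assoc by (simp only: add_left_mono)
    qed
    finally have "real (num_paving n 3) \<le> exp ?C" .
    then have "ln (real (num_paving n 3)) \<le> ?C"
    \<comment> \<open>As \<open>ln 0 = 0\<close> by convention, a zero count is covered by
      \<open>0 \<le> ?C\<close>.\<close>
    proof (cases "num_paving n 3 = 0")
      case False
      then have "ln (real (num_paving n 3)) \<le> ln (exp ?C)"
        using \<open>real (num_paving n 3) \<le> exp ?C\<close> by (subst ln_le_cancel_iff) auto
      then show ?thesis by (simp only: ln_exp)
    qed (use C0 in simp)
    then show ?case
      unfolding rhs .
  qed
  note bound = this
  show ?thesis
  proof (rule exI[of _ "- 1/1000"], rule conjI, simp, rule exI[of _ "\<lambda>_. 0"], rule conjI)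
    show "(\<lambda>_. 0) \<in> o(\<lambda>n. real n)" by simp
  qed (rule bound)
qed

end
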